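(* Let $(T,\Sigma,\mu)$ be a complete $\sigma$-finite measure space, let $Y,Z$ be separable Banach spaces, and let $S:T\rightrightarrows Y\times Z$ be a measurable multifunction with nonempty closed values. If $1\le p,r<\infty$ and $(x,y)\in\mathsf{Sel}_{p,r}(S)$, then $$\{(u,v)\in L^p(T,Y)\times L^r(T,Z): (u(t),v(t))\in\widehat{\mathbf T}_{S(t)}(x(t),y(t))\ \text{a.e.}\}\subset\widehat{\mathbf T}_{\mathsf{Sel}_{p,r}(S)}(x,y).$$
   Context: $L^p(T,Y)$, $L^r(T,Z)$ are Lebesgue--Bochner spaces; $Y\times Z$ carries the norm $\|\cdot\|_Y+\|\cdot\|_Z$ and $L^p(T,Y)\times L^r(T,Z)$ the norm $\|\cdot\|_{L^p}+\|\cdot\|_{L^r}$. A multifunction $S:T\rightrightarrows Y\times Z$ with nonempty closed values is measurable if $\{t: S(t)\cap U\ne\emptyset\}\in\Sigma$ for every open $U\subset Y\times Z$. $$\mathsf{Sel}_{p,r}(S):=\{(a,b)\in L^p(T,Y)\times L^r(T,Z): (a(t),b(t))\in S(t)\text{ a.e.}\}.$$ Clarke tangent cone: for a Banach space $X$ with closed unit ball $\overline{\mathbf B}_X$, a closed set $C\subset X$ and $x\in C$, $\widehat{\mathbf T}_C(x)$ is the set of all $v\in X$ such that for every $\varepsilon>0$ there exist $\delta>0$, $\lambda>0$ such that $C\cap[y+\eta(v+\varepsilon\overline{\mathbf B}_X)]\ne\emptyset$ for every $y\in C\cap(x+\delta\overline{\mathbf B}_X)$ and every $\eta\in[0,\lambda]$.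 *)

theory Defs
  imports "HOL-Analysis.Analysis"
begin

text \<open>
  Lebesgue--Bochner spaces depend on a measure and an exponent, so they cannot be types of class
  \<^class>\<open>banach\<close>; moreover the norm of \<^typ>\<open>'y \<times> 'z\<close> in the library is the Euclidean one, not the sum.
  The Clarke tangent cone is therefore defined once, for normed spaces given by a carrier and
  operations, and this one definition is used both for \<open>Y \<times> Z\<close> and for \<open>L\<^sup>p \<times> L\<^sup>r\<close>.
\<close>

record 'v nspace =
  pts :: "'v set"
  vadd :: "'v \<Rightarrow> 'v \<Rightarrow> 'v"
  vscale :: "real \<Rightarrow> 'v \<Rightarrow> 'v"
  vnorm :: "'v \<Rightarrow> real"

definition type_nspace :: "'v::real_normed_vector nspace" where
  "type_nspace = \<lparr>pts = UNIV, vadd = (+), vscale = scaleR, vnorm = norm\<rparr>"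

definition sum_nspace :: "'u nspace \<Rightarrow> 'v nspace \<Rightarrow> ('u \<times> 'v) nspace" where
  "sum_nspace A B =
    \<lparr>pts = pts A \<times> pts B,
     vadd = (\<lambda>(a, b) (a', b'). (vadd A a a', vadd B b b')),
     vscale = (\<lambda>c (a, b). (vscale A c a, vscale B c b)),
     vnorm = (\<lambda>(a, b). vnorm A a + vnorm B b)\<rparr>"

definition unit_cball :: "'v nspace \<Rightarrow> 'v set" where
  "unit_cball X = {b \<in> pts X. vnorm X b \<le> 1}"

definition clarke_cone :: "'v nspace \<Rightarrow> 'v set \<Rightarrow> 'v \<Rightarrow> 'v set" where
  "clarke_cone X C x =
    {v \<in> pts X. \<forall>\<epsilon>>0. \<exists>\<delta>>0. \<exists>l>0.
       \<forall>y \<in> C \<inter> {vadd X x (vscale X \<delta> b) | b. b \<in> unit_cball X}. \<forall>\<eta>\<in>{0..l}.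
         C \<inter> {vadd X y (vscale X \<eta> (vadd X v (vscale X \<epsilon> b))) | b. b \<in> unit_cball X} \<noteq> {}}"

text \<open>
  For second countable codomains, Borel measurability coincides with strong measurability.
  Elements of \<open>L\<^sup>p\<close> are classes of functions modulo equality almost everywhere; \<open>F(t)\<close> is
  written \<open>Lp_rep F t\<close>, which is determined by \<open>F\<close> for almost every \<open>t\<close>. The representative is
  only used in contexts (integrals, almost-everywhere statements) that do not depend on the choice.
\<close>

definition Lp_fun :: "'a measure \<Rightarrow> real \<Rightarrow> ('a \<Rightarrow> 'b::{banach, second_countable_topology}) set" where
  "Lp_fun M p = {f \<in> borel_measurable M. integrable M (\<lambda>t. norm (f t) powr p)}"

definition Lp_class :: "'a measure \<Rightarrow> real \<Rightarrow> ('a \<Rightarrow> 'b::{banach, second_countable_topology}) \<Rightarrow> ('a \<Rightarrow> 'b) set" where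
  "Lp_class M p f = {g \<in> Lp_fun M p. AE t in M. g t = f t}"

definition Lp_rep :: "('a \<Rightarrow> 'b) set \<Rightarrow> 'a \<Rightarrow> 'b" where
  "Lp_rep F = (SOME f. f \<in> F)"

definition Lp_space :: "'a measure \<Rightarrow> real \<Rightarrow> ('a \<Rightarrow> 'b::{banach, second_countable_topology}) set nspace" where
  "Lp_space M p =
    \<lparr>pts = Lp_class M p ` Lp_fun M p,
     vadd = (\<lambda>F G. Lp_class M p (\<lambda>t. Lp_rep F t + Lp_rep G t)),
     vscale = (\<lambda>c F. Lp_class M p (\<lambda>t. c *\<^sub>R Lp_rep F t)),
     vnorm = (\<lambda>F. (\<integral>t. norm (Lp_rep F t) powr p \<partial>M) powr (1 / p))\<rparr>"

lemma Lp_rep_in: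
  assumes "F \<in> pts (Lp_space M p)"
  shows "Lp_rep F \<in> F" "Lp_rep F \<in> Lp_fun M p"
proof -
  obtain f where f: "f \<in> Lp_fun M p" "F = Lp_class M p f"
    using assms by (auto simp: Lp_space_def)
  then have "f \<in> F" by (simp add: Lp_class_def)
  then show *: "Lp_rep F \<in> F" unfolding Lp_rep_def by (metis someI)
  show "Lp_rep F \<in> Lp_fun M p" using * f by (simp add: Lp_class_def)
qed

lemma Lp_rep_class:
  assumes "f \<in> Lp_fun M p"
  shows "AE t in M. Lp_rep (Lp_class M p f) t = f t"
proof -
  have "Lp_class M p f \<in> pts (Lp_space M p)" using assms by (simp add: Lp_space_def)
  from Lp_rep_in(1)[OF this] show ?thesis by (simp add: Lp_class_def)
qed

definition measurable_multifunction :: "'a measure \<Rightarrow> ('a \<Rightarrow> 'b::topological_space set) \<Rightarrow> bool" where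
  "measurable_multifunction M S \<longleftrightarrow>
    (\<forall>U. open U \<longrightarrow> {t \<in> space M. S t \<inter> U \<noteq> {}} \<in> sets M)"

definition Sel :: "'a measure \<Rightarrow> real \<Rightarrow> real \<Rightarrow>
    ('a \<Rightarrow> ('y::{banach, second_countable_topology} \<times> 'z::{banach, second_countable_topology}) set) \<Rightarrow>
    (('a \<Rightarrow> 'y) set \<times> ('a \<Rightarrow> 'z) set) set" where
  "Sel M p r S =
    {(a, b) \<in> pts (Lp_space M p) \<times> pts (Lp_space M r). AE t in M. (Lp_rep a t, Lp_rep b t) \<in> S t}"

end

theory Submission
  imports Defs
begin

text \<open>
  Fix \<open>\<epsilon>\<close> and a strictly positive function \<open>g\<close> with small \<open>L\<^sup>p\<close> and \<open>L\<^sup>r\<close> norms. Let \<open>A n\<close> be the set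
  of points at which the tangency condition holds with error \<open>g t / 4\<close> and with both radii equal to
  \<open>1 / (n + 1)\<close>; these sets increase to almost all of \<open>T\<close>. Given a selection \<open>(a, b)\<close> close to \<open>(x, y)\<close>,
  move it to a measurable selection near \<open>(a, b) + \<eta> (u, v)\<close> at the points of \<open>A n\<close> where \<open>(a, b)\<close> is
  pointwise close to \<open>(x, y)\<close>, and leave it unchanged elsewhere. The error divided by \<open>\<eta>\<close> is at most \<open>g\<close>
  on the first set and at most \<open>\<bar>u\<bar>\<close>, \<open>\<bar>v\<bar>\<close> on the second one, over which the integral of
  \<open>\<bar>u\<bar>\<^sup>p + \<bar>v\<bar>\<^sup>r\<close> is small by dominated convergence and Markov's inequality.
\<close>

section \<open>Distance functions of multifunctions and measurable selections\<close>

text \<open>For a fixed point \<open>q\<close>, the distance to \<open>S t\<close> is below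
  \<open>e\<close> exactly when \<open>S t\<close> meets the open ball of radius \<open>e\<close>. A
  moving point \<open>z t\<close> is reduced to countably many fixed ones, because the distance
  function is 1-Lipschitz and a dense set can approximate \<open>z t\<close>.\<close>

lemma multifunction_infdist_measurable:
  fixes S :: "'a \<Rightarrow> 'b::{metric_space, second_countable_topology} set"
  assumes S: "measurable_multifunction M S"
    and ne: "\<And>t. t \<in> space M \<Longrightarrow> S t \<noteq> {}"
    and z[measurable]: "z \<in> borel_measurable M"
  shows "(\<lambda>t. infdist (z t) (S t)) \<in> borel_measurable M"
proof -
  have lt: "infdist q (S t) < e \<longleftrightarrow> S t \<inter> ball q e \<noteq> {}" if "t \<in> space M" for q t e
    using ne[OF that] by (auto simp: infdist_notempty cInf_less_iff)
  have q[measurable]: "(\<lambda>t. infdist q (S t)) \<in> borel_measurable M" for q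
  proof (subst borel_measurable_iff_less, intro allI)
    fix e
    have "{t \<in> space M. infdist q (S t) < e} = {t \<in> space M. S t \<inter> ball q e \<noteq> {}}"
      using lt by auto
    then show "{t \<in> space M. infdist q (S t) < e} \<in> sets M"
      using S by (simp add: measurable_multifunction_def)
  qed
  obtain D :: "'b set" where D: "countable D" "\<And>X. open X \<Longrightarrow> X \<noteq> {} \<Longrightarrow> \<exists>d\<in>D. d \<in> X"
    by (rule countable_dense_setE) blast
  show ?thesis
  proof (subst borel_measurable_iff_less, intro allI)
    fix e
    have "(infdist (z t) (S t) < e) \<longleftrightarrow> (\<exists>q\<in>D. dist (z t) q + infdist q (S t) < e)" for t
    proof
      assume less: "infdist (z t) (S t) < e"
      \<comment> \<open>Half of the slack: replacing \<open>z t\<close> by \<open>q\<close> costs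
        \<open>dist (z t) q\<close> twice, once as the explicit summand and once in the distance to
        \<open>S t\<close>.\<close>
      define h where "h = (e - infdist (z t) (S t)) / 2"
      have "ball (z t) h \<noteq> {}" using less by (simp add: h_def)
      then obtain q where q: "q \<in> D" "dist (z t) q < h"
        using D(2)[of "ball (z t) h"] by auto
      have "infdist q (S t) \<le> infdist (z t) (S t) + dist q (z t)"
        by (rule infdist_triangle)
      then have "dist (z t) q + infdist q (S t) < e"
        using q(2) by (simp add: h_def dist_commute field_simps)
      then show "\<exists>q\<in>D. dist (z t) q + infdist q (S t) < e" using q(1) by blast
    next
      assume "\<exists>q\<in>D. dist (z t) q + infdist q (S t) < e"
      then obtain q where "dist (z t) q + infdist q (S t) < e" by blast
      then show "infdist (z t) (S t) < e"
        using infdist_triangle[of "z t" "S t" q] by linarith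
    qed
    then have "{t \<in> space M. infdist (z t) (S t) < e}
      = (\<Union>q\<in>D. {t \<in> space M. dist (z t) q + infdist q (S t) < e})" by auto
    also have "\<dots> \<in> sets M" using D(1) by (intro sets.countable_UN') auto
    finally show "{t \<in> space M. infdist (z t) (S t) < e} \<in> sets M" .
  qed
qed

text \<open>A quantitative form of the Kuratowski--Ryll-Nardzewski construction: the selection is a
  uniform-rate limit of countably valued corrections of \<open>z\<close>. The factor 2 is the sum of
  the geometric series of step lengths.\<close>

lemma measurable_near_selection:
  fixes S :: "'a \<Rightarrow> 'b::{banach, second_countable_topology} set"
  assumes S: "measurable_multifunction M S"
    and ne: "\<And>t. t \<in> space M \<Longrightarrow> S t \<noteq> {}"
    and closed: "\<And>t. t \<in> space M \<Longrightarrow> closed (S t)"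
    and z[measurable]: "z \<in> borel_measurable M"
    and \<rho>[measurable]: "\<rho> \<in> borel_measurable M"
    and near: "\<And>t. t \<in> space M \<Longrightarrow> infdist (z t) (S t) < \<rho> t"
  obtains s where "s \<in> borel_measurable M" "\<And>t. t \<in> space M \<Longrightarrow> s t \<in> S t"
    "\<And>t. t \<in> space M \<Longrightarrow> dist (s t) (z t) \<le> 2 * \<rho> t"
proof -
  note inf_meas = multifunction_infdist_measurable[OF S ne, measurable]
  obtain D :: "'b set" where D: "countable D" "\<And>X. open X \<Longrightarrow> X \<noteq> {} \<Longrightarrow> \<exists>d\<in>D. d \<in> X"
    by (rule countable_dense_setE) blast
  have Dne: "D \<noteq> {}" using D(2)[of UNIV] by auto
  define q where "q = from_nat_into D"
  have q: "\<exists>k. q k \<in> X" if "open X" "X \<noteq> {}" for X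
    using D(2)[OF that] from_nat_into_surj[OF D(1)] unfolding q_def by metis
  \<comment> \<open>Successive approximation: \<open>f (Suc n) t\<close> is the first dense point close enough to \<open>f n t\<close> and to \<open>S t\<close>.\<close>
  define P where "P n f \<longleftrightarrow> f \<in> borel_measurable M \<and> (\<forall>t\<in>space M. infdist (f t) (S t) < \<rho> t * (1/2)^n)
      \<and> (n = 0 \<longrightarrow> f = z)" for n and f :: "'a \<Rightarrow> 'b"
  have step: "\<exists>f'. P (Suc n) f' \<and> (\<forall>t\<in>space M. dist (f t) (f' t) < \<rho> t * (1/2)^n)" if f: "P n f" for n f
  proof -
    have [measurable]: "f \<in> borel_measurable M" using f by (simp add: P_def)
    define R where "R k t \<longleftrightarrow> dist (f t) (q k) < \<rho> t * (1/2)^n \<and> infdist (q k) (S t) < \<rho> t * (1/2)^Suc n" for k t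
    have ex: "\<exists>k. R k t" if t: "t \<in> space M" for t
    proof -
      have pos: "0 < \<rho> t" using near[OF t] infdist_nonneg[of "z t" "S t"] by linarith
      have "infdist (f t) (S t) < \<rho> t * (1/2)^n" using f t by (simp add: P_def)
      then obtain s where s: "s \<in> S t" "dist (f t) s < \<rho> t * (1/2)^n"
        using ne[OF t] by (auto simp: infdist_notempty cInf_less_iff)
      have "s \<in> ball (f t) (\<rho> t * (1/2)^n) \<inter> ball s (\<rho> t * (1/2)^Suc n)"
        using s pos by simp
      then obtain k where k: "q k \<in> ball (f t) (\<rho> t * (1/2)^n) \<inter> ball s (\<rho> t * (1/2)^Suc n)"
        using q[of "ball (f t) (\<rho> t * (1/2)^n) \<inter> ball s (\<rho> t * (1/2)^Suc n)"] by blast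
      have "infdist (q k) (S t) \<le> dist (q k) s" by (rule infdist_le[OF s(1)])
      with k have "R k t" by (simp add: R_def dist_commute)
      then show ?thesis ..
    qed
    have [measurable]: "Measurable.pred M (R k)" for k
      unfolding R_def by measurable
    \<comment> \<open>Choosing the least admissible index makes \<open>f'\<close> countably valued
      with measurable level sets, hence measurable.\<close>
    define f' where "f' t = q (LEAST k. R k t)" for t
    have "R (LEAST k. R k t) t" if "t \<in> space M" for t
      using ex[OF that] by (auto intro: LeastI)
    moreover have "f' \<in> borel_measurable M"
      unfolding f'_def by measurable
    ultimately show ?thesis
      by (intro exI[of _ f']) (auto simp: P_def R_def f'_def)
  qed
  \<comment> \<open>Dependent choice only yields some initial function; the clause for
    \<open>n = 0\<close> in \<open>P\<close> forces it to be \<open>z\<close>.\<close>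
  have "P 0 z" using near by (simp add: P_def)
  then obtain f where f: "\<And>n. P n (f n)"
    and f_step: "\<And>n t. t \<in> space M \<Longrightarrow> dist (f n t) (f (Suc n) t) < \<rho> t * (1/2)^n"
    using dependent_nat_choice[of P "\<lambda>n f f'. \<forall>t\<in>space M. dist (f t) (f' t) < \<rho> t * (1/2)^n"] step
    by (metis (no_types, lifting))
  have f0: "f 0 = z" and [measurable]: "\<And>n. f n \<in> borel_measurable M" using f by (auto simp: P_def)
  define s where "s t = lim (\<lambda>n. f n t)" for t
  have geo: "(\<lambda>n. (1/2::real)^n) sums 2" using geometric_sums[of "1/2::real"] by simp
  have lim: "(\<lambda>n. f n t) \<longlonglongrightarrow> s t" "dist (s t) (z t) \<le> 2 * \<rho> t" if t: "t \<in> space M" for t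
  proof -
    define d where "d n = f (Suc n) t - f n t" for n
    have d: "norm (d n) \<le> \<rho> t * (1/2)^n" for n
      using f_step[OF t, of n] by (simp add: d_def dist_norm norm_minus_commute)
    have g: "(\<lambda>n. \<rho> t * (1/2)^n) sums (\<rho> t * 2)" by (rule sums_mult[OF geo])
    \<comment> \<open>Completeness of the space enters here: norm bounds by a geometric series give
      convergence of the increments.\<close>
    have sd: "summable d" by (rule summable_comparison_test'[OF sums_summable[OF g], of 0]) (rule d)
    have "(\<lambda>n. \<Sum>i<n. d i) \<longlonglongrightarrow> suminf d" by (rule summable_LIMSEQ[OF sd])
    then have "(\<lambda>n. f n t - z t) \<longlonglongrightarrow> suminf d"
      unfolding d_def using sum_lessThan_telescope[of "\<lambda>n. f n t"] by (simp add: f0)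
    then have l: "(\<lambda>n. f n t) \<longlonglongrightarrow> suminf d + z t"
      using tendsto_add[OF _ tendsto_const[of "z t"]] by fastforce
    then have s: "s t = suminf d + z t" unfolding s_def by (rule limI)
    show "(\<lambda>n. f n t) \<longlonglongrightarrow> s t" using l s by simp
    have "norm (suminf d) \<le> (\<Sum>n. \<rho> t * (1/2)^n)"
      by (rule norm_suminf_le[OF d sums_summable[OF g]])
    then show "dist (s t) (z t) \<le> 2 * \<rho> t" using s sums_unique[OF g] by (simp add: dist_norm)
  qed
  show ?thesis
  proof
    show "s \<in> borel_measurable M" unfolding s_def by (rule borel_measurable_lim_metric) measurable
    fix t assume t: "t \<in> space M"
    show "dist (s t) (z t) \<le> 2 * \<rho> t" by (rule lim(2)[OF t])
    have "(\<lambda>n. infdist (f n t) (S t)) \<longlonglongrightarrow> infdist (s t) (S t)"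
      by (rule tendsto_infdist[OF lim(1)[OF t]])
    moreover have "(\<lambda>n. infdist (f n t) (S t)) \<longlonglongrightarrow> 0"
    proof (rule tendsto_sandwich[of "\<lambda>_. 0" _ _ "\<lambda>n. \<rho> t * (1/2)^n"])
      show "(\<lambda>n. \<rho> t * (1/2)^n) \<longlonglongrightarrow> 0"
        using tendsto_mult_right_zero[OF LIMSEQ_power_zero[of "1/2::real"], of "\<rho> t"] by simp
      show "\<forall>\<^sub>F n in sequentially. infdist (f n t) (S t) \<le> \<rho> t * (1/2)^n"
        using f t by (intro always_eventually) (auto simp: P_def less_imp_le)
    qed (auto simp: infdist_nonneg)
    ultimately have "infdist (s t) (S t) = 0" using LIMSEQ_unique by blast
    then show "s t \<in> S t" using in_closed_iff_infdist_zero[OF closed[OF t] ne[OF t]] by simp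
  qed
qed

section \<open>Pointwise tangency with a prescribed error\<close>

text \<open>
  The base point \<open>q\<close> ranges over the whole space and not only over \<open>C\<close>: the condition then involves
  \<open>C\<close> only through its distance function and can be tested on a countable dense set of \<open>(q, \<eta>)\<close>, so
  that its measurability in a parameter does not require a Castaing representation.
\<close>

definition tangent_upto :: "real \<Rightarrow> real \<Rightarrow> 'b::real_normed_vector set \<Rightarrow> 'b \<Rightarrow> 'b \<Rightarrow> bool" where
  "tangent_upto d \<gamma> C x w \<longleftrightarrow>
    (\<forall>q \<eta>. dist q x < d \<and> 0 < \<eta> \<and> \<eta> < d \<longrightarrow> infdist (q + \<eta> *\<^sub>R w) C \<le> infdist q C + \<eta> * \<gamma>)"

lemma tangent_upto_mono: "tangent_upto d \<gamma> C x w \<Longrightarrow> d' \<le> d \<Longrightarrow> tangent_upto d' \<gamma> C x w"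
  by (auto simp: tangent_upto_def)

lemma norm_components_le: "norm (fst q) \<le> norm q" "norm (snd q) \<le> norm q"
  by (cases q; simp only: fst_conv snd_conv norm_fst_le norm_snd_le)+

text \<open>A base point \<open>q\<close> outside \<open>C\<close> is replaced by a nearly nearest
  point \<open>s\<close> of \<open>C\<close>. The cone condition moves \<open>s\<close> within
  \<open>C\<close> along \<open>w\<close>, and the triangle inequality carries the result back to
  \<open>q\<close>.\<close>

lemma clarke_cone_tangent_upto:
  fixes C :: "('y::real_normed_vector \<times> 'z::real_normed_vector) set"
  assumes w: "w \<in> clarke_cone (sum_nspace type_nspace type_nspace) C x"
    and x: "x \<in> C" and \<gamma>: "0 < \<gamma>"
  obtains d where "0 < d" "tangent_upto d \<gamma> C x w"
proof -
  let ?X = "sum_nspace type_nspace type_nspace :: ('y \<times> 'z) nspace"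
  let ?near = "\<lambda>\<delta>. C \<inter> {vadd ?X x (vscale ?X \<delta> b) | b. b \<in> unit_cball ?X}"
  let ?step = "\<lambda>\<epsilon> s \<eta>. {vadd ?X s (vscale ?X \<eta> (vadd ?X w (vscale ?X \<epsilon> b))) | b. b \<in> unit_cball ?X}"
  have "\<forall>\<epsilon>>0. \<exists>\<delta>>0. \<exists>l>0. \<forall>s\<in>?near \<delta>. \<forall>\<eta>\<in>{0..l}. C \<inter> ?step \<epsilon> s \<eta> \<noteq> {}"
    using w unfolding clarke_cone_def mem_Collect_eq by (rule conjunct2)
  from this[THEN spec, THEN mp, OF half_gt_zero[OF \<gamma>]]
  obtain \<delta> l where \<delta>: "0 < \<delta>" and l: "0 < l"
    and *: "\<forall>s\<in>?near \<delta>. \<forall>\<eta>\<in>{0..l}. C \<inter> ?step (\<gamma> / 2) s \<eta> \<noteq> {}"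
    by (elim exE conjE) (rule that)
  have X: "vadd ?X = (+)" "vscale ?X = scaleR"
    by (auto simp: sum_nspace_def type_nspace_def fun_eq_iff)
  have ball: "b \<in> unit_cball ?X \<longleftrightarrow> norm (fst b) + norm (snd b) \<le> 1" for b
    by (cases b) (simp add: unit_cball_def sum_nspace_def type_nspace_def)
  \<comment> \<open>The point \<open>s\<close> chosen below satisfies
    \<open>dist s x < (2 + \<gamma>) * d\<close>; the additional factor 2 passes from the Euclidean
    norm to the sum norm, so that \<open>s\<close> falls into the ball of radius
    \<open>\<delta>\<close>.\<close>
  define d where "d = min l (\<delta> / (2 * (2 + \<gamma>)))"
  have d: "0 < d" "d \<le> l" "d \<le> \<delta> / (2 * (2 + \<gamma>))" using \<delta> l \<gamma> by (simp_all add: d_def)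
  have d_\<delta>: "2 * ((2 + \<gamma>) * d) \<le> \<delta>"
    using d(3) \<gamma> by (subst (asm) pos_le_divide_eq) (simp_all add: algebra_simps)
  have "infdist (q + \<eta> *\<^sub>R w) C \<le> infdist q C + \<eta> * \<gamma>"
    if q: "dist q x < d" and \<eta>: "0 < \<eta>" "\<eta> < d" for q \<eta>
  proof -
    \<comment> \<open>A nearest point need not exist. Being nearly nearest uses half of the error
      \<open>\<eta> * \<gamma>\<close>; the perturbation \<open>b'\<close> uses the other
      half.\<close>
    have "(INF s\<in>C. dist q s) < infdist q C + \<eta> * (\<gamma>/2)"
      using \<eta> \<gamma> x by (subst infdist_notempty[symmetric]) auto
    then obtain s where s: "s \<in> C" "dist q s < infdist q C + \<eta> * (\<gamma>/2)"
      using x by (subst (asm) cInf_less_iff) auto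
    have "infdist q C \<le> dist q x" by (rule infdist_le[OF x])
    moreover have "\<eta> * \<gamma> \<le> d * \<gamma>" using \<eta> \<gamma> by simp
    moreover have "0 < d * \<gamma>" "\<eta> * (\<gamma>/2) = \<eta> * \<gamma> / 2" using d(1) \<gamma> by simp_all
    ultimately have "dist q s < d + d * \<gamma>" using s(2) q by linarith
    then have sx: "dist s x < (2 + \<gamma>) * d"
      using dist_triangle[of s x q] q by (simp add: dist_commute field_simps)
    define b where "b = (1/\<delta>) *\<^sub>R (s - x)"
    \<comment> \<open>The unit ball of the cone belongs to the sum norm, while \<open>dist\<close>
      is Euclidean on the product.\<close>
    have "norm (fst (s - x)) + norm (snd (s - x)) \<le> 2 * norm (s - x)"
      using norm_components_le[of "s - x"] by linarith
    then have "norm (fst (s - x)) + norm (snd (s - x)) \<le> \<delta>"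
      using sx d_\<delta> unfolding dist_norm by linarith
    then have "b \<in> unit_cball ?X"
      using \<delta> unfolding ball b_def fst_scaleR snd_scaleR norm_scaleR
      by (simp add: add_divide_distrib[symmetric] del: fst_diff snd_diff)
    moreover have "s = x + \<delta> *\<^sub>R b" using \<delta> by (simp add: b_def)
    ultimately have "s \<in> ?near \<delta>"
      using s(1) unfolding X by blast
    moreover have "\<eta> \<in> {0..l}" using \<eta> d(2) by simp
    ultimately have "C \<inter> ?step (\<gamma> / 2) s \<eta> \<noteq> {}" using * by blast
    then obtain b' where b': "norm (fst b') + norm (snd b') \<le> 1"
      and c: "s + \<eta> *\<^sub>R (w + (\<gamma>/2) *\<^sub>R b') \<in> C"
      unfolding X ball by blast
    have "norm b' \<le> 1" using b' norm_Pair_le[of "fst b'" "snd b'"] by simp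
    have "q + \<eta> *\<^sub>R w - (s + \<eta> *\<^sub>R (w + (\<gamma>/2) *\<^sub>R b')) = (q - s) - (\<eta> * (\<gamma>/2)) *\<^sub>R b'"
      by (simp add: algebra_simps)
    then have "dist (q + \<eta> *\<^sub>R w) (s + \<eta> *\<^sub>R (w + (\<gamma>/2) *\<^sub>R b')) \<le> norm (q - s) + norm ((\<eta> * (\<gamma>/2)) *\<^sub>R b')"
      unfolding dist_norm by (metis norm_triangle_ineq4)
    also have "\<dots> \<le> dist q s + \<eta> * (\<gamma>/2)"
      using \<open>norm b' \<le> 1\<close> \<eta> \<gamma> mult_left_mono[of "norm b'" 1 "\<eta> * (\<gamma>/2)"] by (simp add: dist_norm)
    also have "\<dots> \<le> infdist q C + \<eta> * \<gamma>" using s(2) by (simp add: field_simps)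
    finally show ?thesis by (rule infdist_le2[OF c])
  qed
  then have "tangent_upto d \<gamma> C x w" by (simp add: tangent_upto_def)
  with d(1) that show ?thesis by blast
qed

text \<open>The pairs \<open>(q, \<eta>)\<close> violating the inequality form an open set, so
  testing on a countable dense set suffices. Each single test compares measurable functions of
  \<open>t\<close>.\<close>

lemma tangent_upto_measurable:
  fixes S :: "'a \<Rightarrow> 'b::{real_normed_vector, second_countable_topology} set"
  assumes S: "measurable_multifunction M S"
    and ne: "\<And>t. t \<in> space M \<Longrightarrow> S t \<noteq> {}"
    and [measurable]: "x \<in> borel_measurable M" "w \<in> borel_measurable M" "\<gamma> \<in> borel_measurable M"
  shows "Measurable.pred M (\<lambda>t. tangent_upto d (\<gamma> t) (S t) (x t) (w t))"
proof -
  have inf_meas: "(\<lambda>t. infdist (z t) (S t)) \<in> borel_measurable M"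
    if "z \<in> borel_measurable M" for z
    by (rule multifunction_infdist_measurable[OF S ne that])
  obtain D :: "('b \<times> real) set" where D: "countable D" "\<And>X. open X \<Longrightarrow> X \<noteq> {} \<Longrightarrow> \<exists>d\<in>D. d \<in> X"
    by (rule countable_dense_setE) blast
  have "tangent_upto d \<gamma> C x w \<longleftrightarrow> (\<forall>(q, \<eta>)\<in>D. dist q x < d \<and> 0 < \<eta> \<and> \<eta> < d \<longrightarrow>
      infdist (q + \<eta> *\<^sub>R w) C \<le> infdist q C + \<eta> * \<gamma>)" (is "_ \<longleftrightarrow> ?R") for \<gamma> C x w
  proof
    assume R: ?R
    define K where "K = {a :: 'b \<times> real. infdist (fst a + snd a *\<^sub>R w) C > infdist (fst a) C + snd a * \<gamma>}"
    have "open K" unfolding K_def by (intro open_Collect_less continuous_intros)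
    then have "open (K \<inter> ball x d \<times> {0<..<d})" by (intro open_Int open_Times) auto
    moreover have "a \<notin> K \<inter> ball x d \<times> {0<..<d}" if "a \<in> D" for a
      using R that by (auto simp: K_def dist_commute)
    ultimately have "K \<inter> ball x d \<times> {0<..<d} = {}" using D(2) by blast
    then have "(q, \<eta>) \<notin> K" if "dist q x < d \<and> 0 < \<eta> \<and> \<eta> < d" for q \<eta>
      using that by (auto simp: dist_commute)
    then show "tangent_upto d \<gamma> C x w"
      unfolding tangent_upto_def K_def by (auto simp: not_less)
  qed (auto simp: tangent_upto_def)
  moreover have "range (from_nat_into D) = D" using D(1) D(2)[of UNIV] by (intro range_from_nat_into) auto
  ultimately have iff: "tangent_upto d \<gamma> C x w \<longleftrightarrow> (\<forall>k. (\<lambda>(q, \<eta>). dist q x < d \<and> 0 < \<eta> \<and> \<eta> < d \<longrightarrow>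
      infdist (q + \<eta> *\<^sub>R w) C \<le> infdist q C + \<eta> * \<gamma>) (from_nat_into D k))" for \<gamma> C x w
    by (metis (mono_tags, lifting) rangeE rangeI)
  have [measurable]: "(\<lambda>t. infdist (q + \<eta> *\<^sub>R w t) (S t)) \<in> borel_measurable M"
    "(\<lambda>t. infdist q (S t)) \<in> borel_measurable M" for q \<eta>
    by (rule inf_meas; measurable)+
  show ?thesis unfolding iff case_prod_beta by measurable
qed

section \<open>Integrability and smallness estimates\<close>

lemma powr_norm_add_le:
  fixes a b :: "'b::real_normed_vector"
  assumes "0 \<le> p"
  shows "norm (a + b) powr p \<le> 2 powr p * (norm a powr p + norm b powr p)"
proof -
  have "norm (a + b) \<le> 2 * max (norm a) (norm b)" using norm_triangle_ineq[of a b] by simp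
  then have "norm (a + b) powr p \<le> (2 * max (norm a) (norm b)) powr p"
    using assms by (intro powr_mono2) auto
  also have "\<dots> = 2 powr p * max (norm a) (norm b) powr p" by (simp add: powr_mult)
  also have "max (norm a) (norm b) powr p \<le> norm a powr p + norm b powr p" by (simp add: max_def)
  finally show ?thesis by simp
qed

lemma Lp_funI_bound:
  assumes "f \<in> borel_measurable M" "integrable M g" "AE t in M. norm (f t) powr p \<le> g t"
  shows "f \<in> Lp_fun M p"
proof -
  have "integrable M (\<lambda>t. norm (f t) powr p)"
    using assms by (intro Bochner_Integration.integrable_bound[OF assms(2)]) (auto elim!: eventually_mono)
  then show ?thesis using assms(1) by (simp add: Lp_fun_def)
qed

lemma Lp_fun_scaleR: "f \<in> Lp_fun M p \<Longrightarrow> (\<lambda>t. c *\<^sub>R f t) \<in> Lp_fun M p"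
  by (auto simp: Lp_fun_def powr_mult)

lemma Lp_fun_add:
  assumes "f \<in> Lp_fun M p" "g \<in> Lp_fun M p" "0 \<le> p"
  shows "(\<lambda>t. f t + g t) \<in> Lp_fun M p"
  using assms
  by (intro Lp_funI_bound[of _ _ "\<lambda>t. 2 powr p * (norm (f t) powr p + norm (g t) powr p)"])
    (auto simp: Lp_fun_def powr_norm_add_le)

lemma Lp_fun_diff:
  assumes "f \<in> Lp_fun M p" "g \<in> Lp_fun M p" "0 \<le> p"
  shows "(\<lambda>t. f t - g t) \<in> Lp_fun M p"
  using Lp_fun_add[OF assms(1) Lp_fun_scaleR[OF assms(2), of "-1"] assms(3)] by simp

text \<open>Truncating at 1 gives \<open>g t powr p \<le> g t\<close> for every
  \<open>p \<ge> 1\<close>, so a single function is small for all these exponents, in particular for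
  both \<open>p\<close> and \<open>r\<close>.\<close>

lemma (in sigma_finite_measure) ex_positive_small_powr_integral:
  assumes "0 < c"
  obtains g :: "'a \<Rightarrow> real" where "g \<in> borel_measurable M" "\<And>t. t \<in> space M \<Longrightarrow> 0 < g t"
    "\<And>p. 1 \<le> p \<Longrightarrow> integrable M (\<lambda>t. g t powr p)" "\<And>p. 1 \<le> p \<Longrightarrow> (\<integral>t. g t powr p \<partial>M) \<le> c"
proof -
  obtain h0 :: "'a \<Rightarrow> ennreal" where h0[measurable]: "h0 \<in> borel_measurable M"
    and fin: "integral\<^sup>N M h0 \<noteq> \<infinity>" and pos: "\<forall>t\<in>space M. 0 < h0 t \<and> h0 t < \<infinity>"
    using Ex_finite_integrable_function by auto
  define h where "h t = enn2real (h0 t)" for t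
  have [measurable]: "h \<in> borel_measurable M" unfolding h_def by measurable
  have h_pos: "0 < h t" if "t \<in> space M" for t
    using pos that by (simp add: h_def enn2real_positive_iff)
  have "(\<integral>\<^sup>+t. ennreal (h t) \<partial>M) = integral\<^sup>N M h0"
    using pos by (intro nn_integral_cong) (simp add: h_def)
  then have h_int: "integrable M h"
    using fin by (intro integrableI_nonneg) (auto simp: h_def top.not_eq_extremum)
  define I where "I = (\<integral>t. h t \<partial>M)"
  have I: "0 \<le> I" unfolding I_def by (intro integral_nonneg_AE) (simp add: h_def)
  \<comment> \<open>The summand 1 keeps the quotient meaningful when \<open>I = 0\<close>.\<close>
  define k where "k = c / (I + 1)"
  have k: "0 < k" "k * I \<le> c" using assms I by (auto simp: k_def field_simps)
  define g where "g t = min 1 (k * h t)" for t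
  have [measurable]: "g \<in> borel_measurable M" unfolding g_def by measurable
  have g_pos: "0 < g t" if "t \<in> space M" for t using k h_pos[OF that] by (simp add: g_def)
  have le: "g t powr p \<le> k * h t" if "t \<in> space M" "1 \<le> p" for t p
  proof -
    have "g t powr p \<le> g t powr 1"
      using g_pos[OF that(1)] that(2) by (intro powr_mono') (auto simp: g_def)
    also have "\<dots> \<le> k * h t" using g_pos[OF that(1)] by (simp add: g_def)
    finally show ?thesis .
  qed
  have int: "integrable M (\<lambda>t. g t powr p)" if "1 \<le> p" for p
    by (rule Bochner_Integration.integrable_bound[of M "\<lambda>t. k * h t"])
       (use h_int le that in \<open>auto intro!: AE_I2 order.trans[OF _ abs_ge_self]\<close>)
  have "(\<integral>t. g t powr p \<partial>M) \<le> c" if "1 \<le> p" for p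
  proof -
    have "(\<integral>t. g t powr p \<partial>M) \<le> (\<integral>t. k * h t \<partial>M)"
      using int[OF that] h_int le that by (intro integral_mono) auto
    then show ?thesis using k by (simp add: I_def)
  qed
  then show ?thesis using g_pos int by (intro that[of g]) auto
qed

text \<open>On the part of \<open>A n\<close> where \<open>h \<le> n\<close>, a set of small measure
  contributes little; the integral over the remaining part tends to zero by dominated convergence.
  Both \<open>n\<close> and \<open>\<kappa>\<close> are fixed before \<open>D\<close>, which makes
  the estimate uniform in \<open>D\<close>.\<close>

lemma integral_small_off_incseq:
  fixes h :: "'a \<Rightarrow> real"
  assumes h: "integrable M h" "\<And>t. 0 \<le> h t"
    and A[measurable]: "\<And>n. A n \<in> sets M" and inc: "incseq A" and cover: "AE t in M. \<exists>n. t \<in> A n"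
    and c: "0 < c"
  obtains n \<kappa> where "0 < \<kappa>"
    "\<And>D. D \<in> fmeasurable M \<Longrightarrow> measure M D \<le> \<kappa> \<Longrightarrow> (\<integral>t. h t * indicator (- A n \<union> D) t \<partial>M) \<le> c"
proof -
  have [measurable]: "h \<in> borel_measurable M" using h by auto
  \<comment> \<open>The part of \<open>h\<close> that is not controlled by the bound
    \<open>n\<close>; it vanishes at each point of some \<open>A m\<close> for all large
    \<open>n\<close>.\<close>
  define f where "f n t = (if t \<in> A n \<and> h t \<le> real n then 0 else h t)" for n t
  have [measurable]: "f n \<in> borel_measurable M" for n unfolding f_def by measurable
  have "(\<lambda>n. f n t) \<longlonglongrightarrow> 0" if "t \<in> A m" for t m
  proof (rule tendsto_eventually)
    obtain k where k: "h t \<le> real k" using real_arch_simple by blast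
    have "f n t = 0" if "max m k \<le> n" for n
      using that k \<open>t \<in> A m\<close> incseqD[OF inc, of m n] by (auto simp: f_def)
    then show "\<forall>\<^sub>F n in sequentially. f n t = 0" by (rule eventually_sequentiallyI)
  qed
  then have "AE t in M. (\<lambda>n. f n t) \<longlonglongrightarrow> 0" using cover by auto
  then have "(\<lambda>n. \<integral>t. f n t \<partial>M) \<longlonglongrightarrow> (\<integral>t. 0 \<partial>M)"
    using h by (intro integral_dominated_convergence[where w=h]) (auto simp: f_def)
  then have "\<forall>\<^sub>F n in sequentially. (\<integral>t. f n t \<partial>M) < c / 2"
    using c by (intro order_tendstoD) auto
  then obtain n where n: "(\<integral>t. f n t \<partial>M) < c / 2"
    using eventually_happens by fastforce
  have fint: "integrable M (f n)"
    by (rule Bochner_Integration.integrable_bound[OF h(1)]) (auto simp: f_def h)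
  define \<kappa> where "\<kappa> = c / (2 * (real n + 1))"
  have "0 < \<kappa>" using c by (simp add: \<kappa>_def)
  moreover have "(\<integral>t. h t * indicator (- A n \<union> D) t \<partial>M) \<le> c"
    if D: "D \<in> fmeasurable M" "measure M D \<le> \<kappa>" for D
  proof -
    have [measurable]: "D \<in> sets M" using D by auto
    have "integrable M (indicator D :: 'a \<Rightarrow> real)"
      using D(1) by (simp add: integrable_indicator_iff fmeasurable_def)
    then have int: "integrable M (\<lambda>t. f n t + real n * indicator D t)" using fint by auto
    have "(\<integral>t. h t * indicator (- A n \<union> D) t \<partial>M) \<le> (\<integral>t. f n t + real n * indicator D t \<partial>M)"
    proof (rule integral_mono'[OF int])
      show "h t * indicator (- A n \<union> D) t \<le> f n t + real n * indicator D t" for t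
        using h(2)[of t] by (auto simp: f_def indicator_def)
      show "0 \<le> f n t + real n * indicator D t" for t using h(2)[of t] by (simp add: f_def)
    qed
    also have "\<dots> = (\<integral>t. f n t \<partial>M) + real n * measure M D"
      using fint \<open>integrable M (indicator D)\<close> D by (simp add: fmeasurable_def)
    also have "real n * measure M D \<le> real n * \<kappa>" using D by (intro mult_left_mono) auto
    also have "\<dots> \<le> c / 2" using c by (simp add: \<kappa>_def field_simps)
    finally show ?thesis using n by simp
  qed
  ultimately show ?thesis by (rule that)
qed

text \<open>Markov's inequality for the \<open>p\<close>-th power gives
  \<open>(\<delta> / d) powr p\<close>. Since \<open>\<delta> \<le> d\<close> and
  \<open>p \<ge> 1\<close>, this is at most \<open>\<delta> / d\<close>, a bound free of the
  exponent that suits both components.\<close>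

lemma Lp_fun_Markov:
  fixes f :: "'a \<Rightarrow> 'b::{banach, second_countable_topology}"
  assumes f: "f \<in> Lp_fun M p" and p: "1 \<le> p" and d: "0 < \<delta>" "\<delta> \<le> d"
    and le: "(\<integral>t. norm (f t) powr p \<partial>M) \<le> \<delta> powr p"
  shows "{t \<in> space M. d \<le> norm (f t)} \<in> fmeasurable M"
    "measure M {t \<in> space M. d \<le> norm (f t)} \<le> \<delta> / d"
proof -
  have [measurable]: "f \<in> borel_measurable M" and int: "integrable M (\<lambda>t. norm (f t) powr p)"
    using f by (auto simp: Lp_fun_def)
  let ?D = "{t \<in> space M. d \<le> norm (f t)}"
  have D: "?D = {t \<in> space M. d powr p \<le> norm (f t) powr p}"
    using d p by (auto intro: powr_mono2) (smt (verit) norm_ge_zero powr_less_mono2)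
  have "emeasure M ?D \<le> (1 / d powr p) * (\<integral>t. norm (f t) powr p \<partial>M)"
    unfolding D using d by (intro integral_Markov_inequality[OF int]) auto
  also have "\<dots> < \<infinity>" by simp
  finally show "?D \<in> fmeasurable M" by (intro fmeasurableI) auto
  have "measure M ?D \<le> (\<integral>t. norm (f t) powr p \<partial>M) / d powr p"
    unfolding D using d by (intro integral_Markov_inequality_measure[OF int sets.empty_sets]) auto
  also have "\<dots> \<le> \<delta> powr p / d powr p" by (intro divide_right_mono le) simp
  also have "\<dots> = (\<delta> / d) powr p" using d by (simp add: powr_divide)
  also have "\<dots> \<le> (\<delta> / d) powr 1" using d p by (intro powr_mono') auto
  also have "\<dots> = \<delta> / d" using d by simp
  finally show "measure M ?D \<le> \<delta> / d" .
qed

section \<open>The main estimate for functions\<close>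

text \<open>The tangency claim for representatives: \<open>e\<close> and \<open>f\<close> are the
  errors of the moved selection after division by \<open>\<eta>\<close>, and their norms are
  expressed through integrals to avoid roots.\<close>

lemma Sel_tangent_estimate:
  fixes S :: "'a \<Rightarrow> ('y::{banach, second_countable_topology} \<times> 'z::{banach, second_countable_topology}) set"
  assumes sigma: "sigma_finite_measure M"
    and ne: "\<And>t. t \<in> space M \<Longrightarrow> S t \<noteq> {}"
    and closed: "\<And>t. t \<in> space M \<Longrightarrow> closed (S t)"
    and S: "measurable_multifunction M S"
    and p: "1 \<le> p" and r: "1 \<le> r"
    and x: "x \<in> Lp_fun M p" and y: "y \<in> Lp_fun M r"
    and u: "u \<in> Lp_fun M p" and v: "v \<in> Lp_fun M r"
    and xy: "AE t in M. (x t, y t) \<in> S t"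
    and tangent: "AE t in M. (u t, v t) \<in> clarke_cone (sum_nspace type_nspace type_nspace) (S t) (x t, y t)"
    and \<epsilon>: "0 < \<epsilon>"
  obtains \<delta> l where "0 < \<delta>" "0 < l"
    "\<And>a b \<eta>. a \<in> Lp_fun M p \<Longrightarrow> b \<in> Lp_fun M r \<Longrightarrow> AE t in M. (a t, b t) \<in> S t \<Longrightarrow>
      (\<integral>t. norm (a t - x t) powr p \<partial>M) \<le> \<delta> powr p \<Longrightarrow> (\<integral>t. norm (b t - y t) powr r \<partial>M) \<le> \<delta> powr r \<Longrightarrow>
      0 < \<eta> \<Longrightarrow> \<eta> \<le> l \<Longrightarrow>
      \<exists>e f. e \<in> Lp_fun M p \<and> f \<in> Lp_fun M r \<and>
        (\<integral>t. norm (e t) powr p \<partial>M) \<le> \<epsilon> powr p \<and> (\<integral>t. norm (f t) powr r \<partial>M) \<le> \<epsilon> powr r \<and>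
        (AE t in M. (a t + \<eta> *\<^sub>R (u t + e t), b t + \<eta> *\<^sub>R (v t + f t)) \<in> S t)"
proof -
  interpret sigma_finite_measure M by (rule sigma)
  have [measurable]: "x \<in> borel_measurable M" "y \<in> borel_measurable M"
    "u \<in> borel_measurable M" "v \<in> borel_measurable M"
    using x y u v by (auto simp: Lp_fun_def)
  have inf_meas: "(\<lambda>t. infdist (z t) (S t)) \<in> borel_measurable M" if "z \<in> borel_measurable M" for z
    by (rule multifunction_infdist_measurable[OF S ne that])
  \<comment> \<open>Each error integral splits into a part bounded through \<open>g\<close> and a
    part bounded through \<open>h\<close>, each at most \<open>c\<close>; halving makes their sum
    fit both exponents.\<close>
  define c where "c = min (\<epsilon> powr p) (\<epsilon> powr r) / 2"
  have c: "0 < c" "2 * c \<le> \<epsilon> powr p" "2 * c \<le> \<epsilon> powr r" using \<epsilon> by (auto simp: c_def)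
  obtain g where g_meas[measurable]: "g \<in> borel_measurable M" and g_pos: "\<And>t. t \<in> space M \<Longrightarrow> 0 < g t"
    and g_int: "\<And>q. 1 \<le> q \<Longrightarrow> integrable M (\<lambda>t. g t powr q)"
    and g_le: "\<And>q. 1 \<le> q \<Longrightarrow> (\<integral>t. g t powr q \<partial>M) \<le> c"
    using ex_positive_small_powr_integral[OF c(1)] by blast
  \<comment> \<open>The fraction \<open>g t / 4\<close> anticipates two doublings:
    \<open>\<rho>\<close> below adds another \<open>\<eta> * (g t / 4)\<close>, and the
    near-selection doubles \<open>\<rho>\<close>, for a total of
    \<open>\<eta> * g t\<close>.\<close>
  define A where "A n = {t \<in> space M. tangent_upto (1 / real (Suc n)) (g t / 4) (S t) (x t, y t) (u t, v t)}" for n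
  have xy_meas: "(\<lambda>t. (x t, y t)) \<in> borel_measurable M" and uv_meas: "(\<lambda>t. (u t, v t)) \<in> borel_measurable M"
    by (rule borel_measurable_Pair; fact)+
  have g4_meas: "(\<lambda>t. g t / 4) \<in> borel_measurable M" by measurable
  have A_meas: "A n \<in> sets M" for n
    unfolding A_def by (rule predE[OF tangent_upto_measurable[OF S ne xy_meas uv_meas g4_meas]])
  have "incseq A"
    unfolding incseq_def A_def by (auto intro: tangent_upto_mono[OF _ frac_le])
  have cover: "AE t in M. \<exists>n. t \<in> A n"
    using xy tangent AE_space
  proof eventually_elim
    case (elim t)
    obtain d where d: "0 < d" "tangent_upto d (g t / 4) (S t) (x t, y t) (u t, v t)"
      using clarke_cone_tangent_upto[OF elim(2,1), of "g t / 4"] g_pos[OF elim(3)] by (metis zero_less_divide_iff zero_less_numeral)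
    obtain n where "1 / real (Suc n) < d" using d(1) nat_approx_posE by blast
    then have "tangent_upto (1 / real (Suc n)) (g t / 4) (S t) (x t, y t) (u t, v t)"
      by (intro tangent_upto_mono[OF d(2)]) simp
    then have "t \<in> A n" using elim(3) by (simp add: A_def)
    then show ?case ..
  qed
  \<comment> \<open>A common majorant, so that one exceptional set serves both components.\<close>
  define h where "h t = norm (u t) powr p + norm (v t) powr r" for t
  have h: "integrable M h" "\<And>t. 0 \<le> h t" using u v by (auto simp: h_def[abs_def] Lp_fun_def)
  obtain n \<kappa> where \<kappa>: "0 < \<kappa>" and small: "\<And>D. D \<in> fmeasurable M \<Longrightarrow> measure M D \<le> \<kappa> \<Longrightarrow>
      (\<integral>t. h t * indicator (- A n \<union> D) t \<partial>M) \<le> c"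
    by (rule integral_small_off_incseq[OF h A_meas \<open>incseq A\<close> cover c(1)]) (rule that)
  define d where "d = 1 / real (Suc n)"
  have d: "0 < d" by (simp add: d_def)
  \<comment> \<open>By Markov each of the two sets where a component is at least
    \<open>d / 2\<close> away has measure at most \<open>\<delta> / (d / 2)\<close>, hence at most
    \<open>\<kappa> / 2\<close>.\<close>
  define \<delta> where "\<delta> = min (d / 2) (\<kappa> * d / 4)"
  have \<delta>: "0 < \<delta>" "\<delta> \<le> d / 2" "\<delta> / (d / 2) + \<delta> / (d / 2) \<le> \<kappa>"
    using d \<kappa> by (auto simp: \<delta>_def min_def field_simps)
  show ?thesis
  \<comment> \<open>Steps up to \<open>d / 2\<close> satisfy the strict bound
    \<open>\<eta> < d\<close> in \<open>tangent_upto\<close>.\<close>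
  proof (rule that[OF \<delta>(1), of "d / 2"])
    show "0 < d / 2" using d by simp
    fix a b \<eta>
    assume a: "a \<in> Lp_fun M p" and b: "b \<in> Lp_fun M r" and ab: "AE t in M. (a t, b t) \<in> S t"
      and a_near: "(\<integral>t. norm (a t - x t) powr p \<partial>M) \<le> \<delta> powr p"
      and b_near: "(\<integral>t. norm (b t - y t) powr r \<partial>M) \<le> \<delta> powr r"
      and \<eta>: "0 < \<eta>" "\<eta> \<le> d / 2"
    have [measurable]: "a \<in> borel_measurable M" "b \<in> borel_measurable M"
      using a b by (auto simp: Lp_fun_def)
    define D1 where "D1 = {t \<in> space M. d / 2 \<le> norm (a t - x t)}"
    define D2 where "D2 = {t \<in> space M. d / 2 \<le> norm (b t - y t)}"
    have D1: "D1 \<in> fmeasurable M" "measure M D1 \<le> \<delta> / (d / 2)"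
      using Lp_fun_Markov[OF Lp_fun_diff[OF a x] p \<delta>(1,2) a_near] p by (simp_all add: D1_def)
    have D2: "D2 \<in> fmeasurable M" "measure M D2 \<le> \<delta> / (d / 2)"
      using Lp_fun_Markov[OF Lp_fun_diff[OF b y] r \<delta>(1,2) b_near] r by (simp_all add: D2_def)
    have "D1 \<union> D2 \<in> fmeasurable M" using D1 D2 by blast
    moreover have "measure M (D1 \<union> D2) \<le> \<kappa>"
      using measure_Un_le[of D1 M D2] D1 D2 \<delta>(3) by (simp add: fmeasurableD)
    ultimately have h_small: "(\<integral>t. h t * indicator (- A n \<union> (D1 \<union> D2)) t \<partial>M) \<le> c" by (rule small)
    define z where "z t = (a t, b t) + \<eta> *\<^sub>R (u t, v t)" for t
    \<comment> \<open>The positive summand supplies the strict inequality that the near-selection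
      requires.\<close>
    define \<rho> where "\<rho> t = infdist (z t) (S t) + \<eta> * (g t / 4)" for t
    have ab_meas: "(\<lambda>t. (a t, b t)) \<in> borel_measurable M" by (rule borel_measurable_Pair; fact)
    have z_meas[measurable]: "z \<in> borel_measurable M"
      unfolding z_def by (intro borel_measurable_add borel_measurable_scaleR borel_measurable_const ab_meas uv_meas)
    have \<rho>_meas: "\<rho> \<in> borel_measurable M" unfolding \<rho>_def
      by (intro borel_measurable_add borel_measurable_times borel_measurable_const inf_meas z_meas g4_meas)
    have near: "infdist (z t) (S t) < \<rho> t" if "t \<in> space M" for t
      using g_pos[OF that] \<eta>(1) by (simp add: \<rho>_def)
    obtain s where s_meas[measurable]: "s \<in> borel_measurable M" and s: "\<And>t. t \<in> space M \<Longrightarrow> s t \<in> S t"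
      and s_near: "\<And>t. t \<in> space M \<Longrightarrow> dist (s t) (z t) \<le> 2 * \<rho> t"
      using measurable_near_selection[OF S ne closed z_meas \<rho>_meas near] by blast
    define G where "G = A n - (D1 \<union> D2)"
    have [measurable]: "G \<in> sets M" using A_meas D1 D2 by (auto simp: G_def fmeasurableD)
    \<comment> \<open>On \<open>G\<close> the errors are chosen so that the moved pair is exactly
      \<open>s t\<close>; off \<open>G\<close> they cancel the direction, so the pair stays at
      \<open>(a t, b t)\<close>.\<close>
    define e where "e t = (if t \<in> G then (1 / \<eta>) *\<^sub>R (fst (s t) - a t) - u t else - u t)" for t
    define f where "f t = (if t \<in> G then (1 / \<eta>) *\<^sub>R (snd (s t) - b t) - v t else - v t)" for t
    have [measurable]: "(\<lambda>t. fst (s t)) \<in> borel_measurable M" "(\<lambda>t. snd (s t)) \<in> borel_measurable M"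
      by (rule borel_measurable_continuous_on[OF _ s_meas]; intro continuous_intros)+
    have e_meas[measurable]: "e \<in> borel_measurable M" unfolding e_def by measurable
    have f_meas[measurable]: "f \<in> borel_measurable M" unfolding f_def by measurable
    have ef: "norm (e t) \<le> g t" "norm (f t) \<le> g t" if t: "t \<in> G" and S_t: "(a t, b t) \<in> S t" for t
    proof -
      have sp: "t \<in> space M" using t by (auto simp: G_def A_def)
      have "dist (a t, b t) (x t, y t) \<le> norm (a t - x t) + norm (b t - y t)"
        using norm_Pair_le[of "a t - x t" "b t - y t"] by (simp add: dist_norm)
      also have "\<dots> < d" using t sp by (auto simp: G_def D1_def D2_def)
      finally have "dist (a t, b t) (x t, y t) < d" .
      moreover have "tangent_upto d (g t / 4) (S t) (x t, y t) (u t, v t)"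
        using t by (simp add: G_def A_def d_def)
      moreover have "\<eta> < d" using \<eta> by linarith
      ultimately have "infdist (z t) (S t) \<le> infdist (a t, b t) (S t) + \<eta> * (g t / 4)"
        using \<eta>(1) unfolding tangent_upto_def z_def by blast
      then have "\<rho> t \<le> \<eta> * g t / 2" using S_t by (simp add: \<rho>_def)
      then have "norm (s t - z t) \<le> \<eta> * g t" using s_near[OF sp] by (simp add: dist_norm)
      moreover have "e t = (1 / \<eta>) *\<^sub>R fst (s t - z t)" "f t = (1 / \<eta>) *\<^sub>R snd (s t - z t)"
        using t \<eta>(1) by (simp_all add: e_def f_def z_def algebra_simps)
      then have "norm (e t) = norm (fst (s t - z t)) / \<eta>" "norm (f t) = norm (snd (s t - z t)) / \<eta>"
        using \<eta>(1) by simp_all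
      moreover have "norm (fst (s t - z t)) \<le> norm (s t - z t)" "norm (snd (s t - z t)) \<le> norm (s t - z t)"
        by (rule norm_components_le)+
      ultimately show "norm (e t) \<le> g t" "norm (f t) \<le> g t"
        using \<eta>(1) by (simp_all add: pos_divide_le_eq mult.commute)
    qed
    \<comment> \<open>Stated for an arbitrary codomain and exponent in order to serve
      \<open>e\<close> with \<open>p\<close> and \<open>f\<close> with \<open>r\<close>.\<close>
    have split: "k \<in> Lp_fun M q \<and> (\<integral>t. norm (k t) powr q \<partial>M) \<le> 2 * c"
      if q: "1 \<le> q" and k: "k \<in> borel_measurable M"
        and good: "\<And>t. t \<in> G \<Longrightarrow> (a t, b t) \<in> S t \<Longrightarrow> norm (k t) \<le> g t"
        and bad: "\<And>t. t \<notin> G \<Longrightarrow> norm (k t) powr q \<le> h t" for k :: "'a \<Rightarrow> 'c::{banach, second_countable_topology}" and q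
    proof -
      let ?B = "\<lambda>t. g t powr q + h t * indicator (- A n \<union> (D1 \<union> D2)) t"
      have B: "integrable M (\<lambda>t. h t * indicator (- A n \<union> (D1 \<union> D2)) t)"
      proof (rule Bochner_Integration.integrable_bound[OF h(1)])
        \<comment> \<open>The complement \<open>- A n\<close> is taken in the whole type and may not
          be a measurable set; on \<open>space M\<close> its union with
          \<open>D1 \<union> D2\<close> agrees with \<open>space M - G\<close>.\<close>
        have "(\<lambda>t. h t * indicator (space M - G) t) \<in> borel_measurable M"
          using h(1) by measurable
        also have "?this \<longleftrightarrow> (\<lambda>t. h t * indicator (- A n \<union> (D1 \<union> D2)) t) \<in> borel_measurable M"
          by (intro measurable_cong) (auto simp: G_def indicator_def)
        finally show "(\<lambda>t. h t * indicator (- A n \<union> (D1 \<union> D2)) t) \<in> borel_measurable M" .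
      qed (auto simp: h(2) indicator_def)
      have le: "AE t in M. norm (k t) powr q \<le> ?B t"
        using ab
      proof eventually_elim
        case (elim t)
        show ?case
        proof (cases "t \<in> G")
          case True
          then have "norm (k t) powr q \<le> g t powr q" using good elim q by (intro powr_mono2) auto
          then show ?thesis using True h(2)[of t] by (simp add: G_def)
        next
          case False
          then have "t \<in> - A n \<union> (D1 \<union> D2)" by (auto simp: G_def)
          then show ?thesis using bad[OF False] by (simp add: add_increasing)
        qed
      qed
      have kL: "k \<in> Lp_fun M q"
        using g_int[OF q] B by (intro Lp_funI_bound[OF k _ le]) simp
      then have "(\<integral>t. norm (k t) powr q \<partial>M) \<le> (\<integral>t. ?B t \<partial>M)"
        using g_int[OF q] B by (intro integral_mono_AE le) (auto simp: Lp_fun_def)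
      also have "\<dots> \<le> c + c" using g_int[OF q] B g_le[OF q] h_small by simp
      finally show ?thesis using kL by simp
    qed
    have e: "e \<in> Lp_fun M p \<and> (\<integral>t. norm (e t) powr p \<partial>M) \<le> 2 * c"
      by (rule split[OF p e_meas ef(1)]) (auto simp: e_def h_def)
    have f: "f \<in> Lp_fun M r \<and> (\<integral>t. norm (f t) powr r \<partial>M) \<le> 2 * c"
      by (rule split[OF r f_meas ef(2)]) (auto simp: f_def h_def)
    have "AE t in M. (a t + \<eta> *\<^sub>R (u t + e t), b t + \<eta> *\<^sub>R (v t + f t)) \<in> S t"
      using ab AE_space
    proof eventually_elim
      case (elim t)
      then show ?case using s[of t] \<eta>(1) by (simp add: e_def f_def)
    qed
    then show "\<exists>e f. e \<in> Lp_fun M p \<and> f \<in> Lp_fun M r \<and>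
        (\<integral>t. norm (e t) powr p \<partial>M) \<le> \<epsilon> powr p \<and> (\<integral>t. norm (f t) powr r \<partial>M) \<le> \<epsilon> powr r \<and>
        (AE t in M. (a t + \<eta> *\<^sub>R (u t + e t), b t + \<eta> *\<^sub>R (v t + f t)) \<in> S t)"
      using e f c by (intro exI[of _ e] exI[of _ f]) auto
  qed
qed

section \<open>Passage from functions to classes modulo null sets\<close>

lemma Lp_class_in: "f \<in> Lp_fun M p \<Longrightarrow> Lp_class M p f \<in> pts (Lp_space M p)"
  by (simp add: Lp_space_def)

lemma Lp_space_vadd:
  assumes "F \<in> pts (Lp_space M p)" "G \<in> pts (Lp_space M p)" "0 \<le> p"
  shows "vadd (Lp_space M p) F G \<in> pts (Lp_space M p)"
    "AE t in M. Lp_rep (vadd (Lp_space M p) F G) t = Lp_rep F t + Lp_rep G t"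
  using Lp_fun_add[OF Lp_rep_in(2)[OF assms(1)] Lp_rep_in(2)[OF assms(2)] assms(3)]
  by (auto simp: Lp_space_def dest: Lp_rep_class)

lemma Lp_space_vscale:
  assumes "F \<in> pts (Lp_space M p)"
  shows "vscale (Lp_space M p) k F \<in> pts (Lp_space M p)"
    "AE t in M. Lp_rep (vscale (Lp_space M p) k F) t = k *\<^sub>R Lp_rep F t"
  using Lp_fun_scaleR[OF Lp_rep_in(2)[OF assms]]
  by (auto simp: Lp_space_def dest: Lp_rep_class)

lemma Lp_space_vadd_vscale:
  assumes "F \<in> pts (Lp_space M p)" "G \<in> pts (Lp_space M p)" "0 \<le> p"
  shows "vadd (Lp_space M p) F (vscale (Lp_space M p) k G) \<in> pts (Lp_space M p)"
    "AE t in M. Lp_rep (vadd (Lp_space M p) F (vscale (Lp_space M p) k G)) t = Lp_rep F t + k *\<^sub>R Lp_rep G t"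
proof -
  note add = Lp_space_vadd[OF assms(1) Lp_space_vscale(1)[OF assms(2)] assms(3), of k]
  show "vadd (Lp_space M p) F (vscale (Lp_space M p) k G) \<in> pts (Lp_space M p)" by (rule add(1))
  show "AE t in M. Lp_rep (vadd (Lp_space M p) F (vscale (Lp_space M p) k G)) t = Lp_rep F t + k *\<^sub>R Lp_rep G t"
    using add(2) Lp_space_vscale(2)[OF assms(2), of k] by eventually_elim simp
qed

lemma Lp_vnorm_nonneg: "0 \<le> vnorm (Lp_space M p) F"
  by (simp add: Lp_space_def)

text \<open>Removes the root from the norm and allows any measurable function equal almost
  everywhere to the chosen representative.\<close>

lemma Lp_vnorm_le_iff:
  assumes F: "F \<in> pts (Lp_space M p)" and f: "AE t in M. Lp_rep F t = f t" "f \<in> borel_measurable M"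
    and p: "1 \<le> p" and k: "0 \<le> k"
  shows "vnorm (Lp_space M p) F \<le> k \<longleftrightarrow> (\<integral>t. norm (f t) powr p \<partial>M) \<le> k powr p"
proof -
  have [measurable]: "Lp_rep F \<in> borel_measurable M" using Lp_rep_in(2)[OF F] by (simp add: Lp_fun_def)
  have I: "(\<integral>t. norm (Lp_rep F t) powr p \<partial>M) = (\<integral>t. norm (f t) powr p \<partial>M)"
    using f by (intro integral_cong_AE) auto
  let ?I = "\<integral>t. norm (f t) powr p \<partial>M"
  have "0 \<le> ?I" by (intro integral_nonneg_AE) simp
  have "?I powr (1 / p) \<le> k \<longleftrightarrow> ?I \<le> k powr p"
  proof
    assume "?I powr (1 / p) \<le> k"
    then have "(?I powr (1 / p)) powr p \<le> k powr p" using p by (intro powr_mono2) auto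
    then show "?I \<le> k powr p" using p \<open>0 \<le> ?I\<close> by (simp add: powr_powr)
  next
    assume "?I \<le> k powr p"
    then have "?I powr (1 / p) \<le> (k powr p) powr (1 / p)" using p \<open>0 \<le> ?I\<close> by (intro powr_mono2) auto
    then show "?I powr (1 / p) \<le> k" using p k by (simp add: powr_powr)
  qed
  then show ?thesis by (simp add: Lp_space_def I)
qed

lemma integral_powr_norm_scaleR_le:
  assumes "(\<integral>t. norm (f t) powr p \<partial>M) \<le> k powr p" "0 \<le> k" "0 \<le> c"
  shows "(\<integral>t. norm (c *\<^sub>R f t) powr p \<partial>M) \<le> (c * k) powr p"
  using mult_left_mono[OF assms(1), of "c powr p"] assms(2,3) by (simp add: powr_mult)

lemma Lp_dist_le_of_ball:
  assumes F: "F \<in> pts (Lp_space M p)" and B: "B \<in> pts (Lp_space M p)" "vnorm (Lp_space M p) B \<le> 1"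
    and p: "1 \<le> p" and \<delta>: "0 \<le> \<delta>"
  shows "(\<integral>t. norm (Lp_rep (vadd (Lp_space M p) F (vscale (Lp_space M p) \<delta> B)) t - Lp_rep F t) powr p \<partial>M) \<le> \<delta> powr p"
proof -
  let ?A = "vadd (Lp_space M p) F (vscale (Lp_space M p) \<delta> B)"
  have A: "?A \<in> pts (Lp_space M p)" "AE t in M. Lp_rep ?A t = Lp_rep F t + \<delta> *\<^sub>R Lp_rep B t"
    using Lp_space_vadd_vscale[OF F B(1)] p by auto
  have [measurable]: "Lp_rep F \<in> borel_measurable M" "Lp_rep ?A \<in> borel_measurable M" "Lp_rep B \<in> borel_measurable M"
    using F A B Lp_rep_in(2) by (auto simp: Lp_fun_def)
  have "(\<integral>t. norm (Lp_rep ?A t - Lp_rep F t) powr p \<partial>M) = (\<integral>t. \<delta> powr p * norm (Lp_rep B t) powr p \<partial>M)"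
    using A(2) \<delta> by (intro integral_cong_AE) (auto simp: powr_mult elim!: eventually_mono)
  also have "\<dots> \<le> \<delta> powr p * 1"
    using B(2) Lp_vnorm_le_iff[OF B(1), of "Lp_rep B" 1] p by (simp add: mult_left_le)
  finally show ?thesis by simp
qed

theorem corollary4p5:
  fixes M :: "'a measure"
    and S :: "'a \<Rightarrow> ('y::{banach, second_countable_topology} \<times> 'z::{banach, second_countable_topology}) set"
    and p r :: real
    and x :: "('a \<Rightarrow> 'y) set" and y :: "('a \<Rightarrow> 'z) set"
  assumes "complete_measure M" and "sigma_finite_measure M"
    and "\<And>t. t \<in> space M \<Longrightarrow> S t \<noteq> {}"
    and "\<And>t. t \<in> space M \<Longrightarrow> closed (S t)"
    and "measurable_multifunction M S"
    and "1 \<le> p" and "1 \<le> r"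
    and "(x, y) \<in> Sel M p r S"
  shows "{(u, v) \<in> pts (Lp_space M p) \<times> pts (Lp_space M r).
           AE t in M. (Lp_rep u t, Lp_rep v t)
             \<in> clarke_cone (sum_nspace type_nspace type_nspace) (S t) (Lp_rep x t, Lp_rep y t)}
         \<subseteq> clarke_cone (sum_nspace (Lp_space M p) (Lp_space M r)) (Sel M p r S) (x, y)"
    (is "?L \<subseteq> ?K")
proof
  fix w assume "w \<in> ?L"
  then obtain u v where w: "w = (u, v)" and u: "u \<in> pts (Lp_space M p)" and v: "v \<in> pts (Lp_space M r)"
    and tangent: "AE t in M. (Lp_rep u t, Lp_rep v t)
      \<in> clarke_cone (sum_nspace type_nspace type_nspace) (S t) (Lp_rep x t, Lp_rep y t)"
    by (cases w) auto
  let ?P = "Lp_space M p :: ('a \<Rightarrow> 'y) set nspace" and ?R = "Lp_space M r :: ('a \<Rightarrow> 'z) set nspace"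
  let ?X = "sum_nspace ?P ?R"
  have x: "x \<in> pts ?P" and y: "y \<in> pts ?R" and xy: "AE t in M. (Lp_rep x t, Lp_rep y t) \<in> S t"
    using assms(8) by (auto simp: Sel_def)
  have X: "pts ?X = pts ?P \<times> pts ?R" "vadd ?X (F, G) (F', G') = (vadd ?P F F', vadd ?R G G')"
    "vscale ?X k (F, G) = (vscale ?P k F, vscale ?R k G)" for F F' G G' k
    by (simp_all add: sum_nspace_def)
  have ball: "(F, G) \<in> unit_cball ?X \<longleftrightarrow>
      F \<in> pts ?P \<and> G \<in> pts ?R \<and> vnorm ?P F + vnorm ?R G \<le> 1" for F G
    by (auto simp: unit_cball_def sum_nspace_def)
  have p0: "0 \<le> p" and r0: "0 \<le> r" using assms(6,7) by auto
  show "w \<in> ?K"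
    unfolding w clarke_cone_def
  proof (intro CollectI conjI allI impI)
    show "(u, v) \<in> pts ?X" using u v by (simp add: X)
    fix \<epsilon> :: real assume \<epsilon>: "0 < \<epsilon>"
    \<comment> \<open>Using \<open>\<epsilon> / 2\<close> for each component keeps the sum of the
      two error norms within \<open>\<epsilon>\<close>.\<close>
    obtain \<delta> l where \<delta>: "0 < \<delta>" and l: "0 < l"
      and step: "\<And>a b \<eta>. a \<in> Lp_fun M p \<Longrightarrow> b \<in> Lp_fun M r \<Longrightarrow> AE t in M. (a t, b t) \<in> S t \<Longrightarrow>
        (\<integral>t. norm (a t - Lp_rep x t) powr p \<partial>M) \<le> \<delta> powr p \<Longrightarrow>
        (\<integral>t. norm (b t - Lp_rep y t) powr r \<partial>M) \<le> \<delta> powr r \<Longrightarrow> 0 < \<eta> \<Longrightarrow> \<eta> \<le> l \<Longrightarrow>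
        \<exists>e f. e \<in> Lp_fun M p \<and> f \<in> Lp_fun M r \<and>
          (\<integral>t. norm (e t) powr p \<partial>M) \<le> (\<epsilon> / 2) powr p \<and> (\<integral>t. norm (f t) powr r \<partial>M) \<le> (\<epsilon> / 2) powr r \<and>
          (AE t in M. (a t + \<eta> *\<^sub>R (Lp_rep u t + e t), b t + \<eta> *\<^sub>R (Lp_rep v t + f t)) \<in> S t)"
      by (rule Sel_tangent_estimate[OF assms(2-7) Lp_rep_in(2)[OF x] Lp_rep_in(2)[OF y]
          Lp_rep_in(2)[OF u] Lp_rep_in(2)[OF v] xy tangent half_gt_zero[OF \<epsilon>]]) (assumption+, rule that)
    show "\<exists>\<delta>>0. \<exists>l>0. \<forall>s \<in> Sel M p r S \<inter> {vadd ?X (x, y) (vscale ?X \<delta> b) | b. b \<in> unit_cball ?X}. \<forall>\<eta>\<in>{0..l}.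
      Sel M p r S \<inter> {vadd ?X s (vscale ?X \<eta> (vadd ?X (u, v) (vscale ?X \<epsilon> b))) | b. b \<in> unit_cball ?X} \<noteq> {}"
    proof (rule exI[of _ \<delta>], rule conjI[OF \<delta>], rule exI[of _ l], rule conjI[OF l], intro ballI)
      fix s \<eta>
      assume s: "s \<in> Sel M p r S \<inter> {vadd ?X (x, y) (vscale ?X \<delta> b) | b. b \<in> unit_cball ?X}" and \<eta>: "\<eta> \<in> {0..l}"
      obtain a b where s_eq: "s = (a, b)" by (cases s)
      have a: "a \<in> pts ?P" and b: "b \<in> pts ?R" and ab: "AE t in M. (Lp_rep a t, Lp_rep b t) \<in> S t"
        using s by (simp_all add: s_eq Sel_def)
      from s obtain B where "B \<in> unit_cball ?X" "s = vadd ?X (x, y) (vscale ?X \<delta> B)" by blast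
      then obtain B1 B2 where "(B1, B2) \<in> unit_cball ?X" "s = vadd ?X (x, y) (vscale ?X \<delta> (B1, B2))"
        by (metis prod.collapse)
      then have B: "B1 \<in> pts ?P" "B2 \<in> pts ?R" "vnorm ?P B1 + vnorm ?R B2 \<le> 1"
        and ab_eq: "a = vadd ?P x (vscale ?P \<delta> B1)" "b = vadd ?R y (vscale ?R \<delta> B2)"
        by (simp_all add: s_eq X ball)
      have "vnorm ?P B1 \<le> 1" "vnorm ?R B2 \<le> 1"
        using B(3) Lp_vnorm_nonneg[of M p B1] Lp_vnorm_nonneg[of M r B2] by linarith+
      then have near: "(\<integral>t. norm (Lp_rep a t - Lp_rep x t) powr p \<partial>M) \<le> \<delta> powr p"
          "(\<integral>t. norm (Lp_rep b t - Lp_rep y t) powr r \<partial>M) \<le> \<delta> powr r"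
        using Lp_dist_le_of_ball[OF x B(1) _ assms(6), of \<delta>] Lp_dist_le_of_ball[OF y B(2) _ assms(7), of \<delta>] \<delta>
        by (simp_all add: ab_eq)
      have "\<exists>e f. e \<in> Lp_fun M p \<and> f \<in> Lp_fun M r \<and>
          (\<integral>t. norm (e t) powr p \<partial>M) \<le> (\<epsilon> / 2) powr p \<and> (\<integral>t. norm (f t) powr r \<partial>M) \<le> (\<epsilon> / 2) powr r \<and>
          (AE t in M. (Lp_rep a t + \<eta> *\<^sub>R (Lp_rep u t + e t), Lp_rep b t + \<eta> *\<^sub>R (Lp_rep v t + f t)) \<in> S t)"
      \<comment> \<open>The cone admits \<open>\<eta> = 0\<close>, where dividing by
        \<open>\<eta>\<close> is impossible; the zero errors work because \<open>(a, b)\<close> is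
        itself a selection.\<close>
      proof (cases "\<eta> = 0")
        case True
        then show ?thesis using ab
          by (intro exI[of _ "\<lambda>_. 0 :: 'y"] exI[of _ "\<lambda>_. 0 :: 'z"]) (simp add: Lp_fun_def)
      next
        case False
        then show ?thesis
          using \<eta> by (intro step[OF Lp_rep_in(2)[OF a] Lp_rep_in(2)[OF b] ab near]) simp_all
      qed
      then obtain e f where e: "e \<in> Lp_fun M p" "(\<integral>t. norm (e t) powr p \<partial>M) \<le> (\<epsilon> / 2) powr p"
        and f: "f \<in> Lp_fun M r" "(\<integral>t. norm (f t) powr r \<partial>M) \<le> (\<epsilon> / 2) powr r"
        and sel: "AE t in M. (Lp_rep a t + \<eta> *\<^sub>R (Lp_rep u t + e t), Lp_rep b t + \<eta> *\<^sub>R (Lp_rep v t + f t)) \<in> S t"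
        by blast
      \<comment> \<open>Rescaling by \<open>1 / \<epsilon>\<close> turns the errors into a point of
        the unit ball, each component having norm at most \<open>1 / 2\<close>.\<close>
      define E where "E = Lp_class M p (\<lambda>t. (1 / \<epsilon>) *\<^sub>R e t)"
      define F where "F = Lp_class M r (\<lambda>t. (1 / \<epsilon>) *\<^sub>R f t)"
      have E: "E \<in> pts ?P" "AE t in M. Lp_rep E t = (1 / \<epsilon>) *\<^sub>R e t"
        unfolding E_def by (rule Lp_class_in Lp_rep_class; rule Lp_fun_scaleR[OF e(1)])+
      have F: "F \<in> pts ?R" "AE t in M. Lp_rep F t = (1 / \<epsilon>) *\<^sub>R f t"
        unfolding F_def by (rule Lp_class_in Lp_rep_class; rule Lp_fun_scaleR[OF f(1)])+
      have "vnorm ?P E \<le> 1 / 2"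
        using integral_powr_norm_scaleR_le[OF e(2), of "1 / \<epsilon>"] Lp_fun_scaleR[OF e(1), of "1 / \<epsilon>"] \<epsilon>
        by (subst Lp_vnorm_le_iff[OF E _ assms(6)]) (simp_all add: Lp_fun_def)
      moreover have "vnorm ?R F \<le> 1 / 2"
        using integral_powr_norm_scaleR_le[OF f(2), of "1 / \<epsilon>"] Lp_fun_scaleR[OF f(1), of "1 / \<epsilon>"] \<epsilon>
        by (subst Lp_vnorm_le_iff[OF F _ assms(7)]) (simp_all add: Lp_fun_def)
      ultimately have EF: "(E, F) \<in> unit_cball ?X" using E F by (simp add: ball)
      let ?a = "vadd ?P a (vscale ?P \<eta> (vadd ?P u (vscale ?P \<epsilon> E)))"
      let ?b = "vadd ?R b (vscale ?R \<eta> (vadd ?R v (vscale ?R \<epsilon> F)))"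
      note uE = Lp_space_vadd_vscale[OF u E(1) p0, of \<epsilon>] and vF = Lp_space_vadd_vscale[OF v F(1) r0, of \<epsilon>]
      note a' = Lp_space_vadd_vscale[OF a uE(1) p0, of \<eta>] and b' = Lp_space_vadd_vscale[OF b vF(1) r0, of \<eta>]
      \<comment> \<open>Representatives respect the operations only almost everywhere, so the
        finitely many exceptional null sets are combined here.\<close>
      have "AE t in M. (Lp_rep ?a t, Lp_rep ?b t) \<in> S t"
        using sel a'(2) b'(2) uE(2) vF(2) E(2) F(2)
        by eventually_elim (use \<epsilon> in simp)
      then have "(?a, ?b) \<in> Sel M p r S" using a'(1) b'(1) by (simp add: Sel_def)
      moreover have "(?a, ?b) = vadd ?X s (vscale ?X \<eta> (vadd ?X (u, v) (vscale ?X \<epsilon> (E, F))))"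
        by (simp add: s_eq X)
      ultimately show "Sel M p r S \<inter> {vadd ?X s (vscale ?X \<eta> (vadd ?X (u, v) (vscale ?X \<epsilon> b))) | b. b \<in> unit_cball ?X} \<noteq> {}"
        using EF by blast
    qed
  qed
qed

end
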